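(* Let $P$ be a partially ordered set. (i) Let $(x_\alpha)_{\alpha\in A}$, $(y_\alpha)_{\alpha\in A}$ and $(z_\alpha)_{\alpha\in A}$ be nets in $P$ such that $x_\alpha\xrightarrow{o_1}p\in P$ and $z_\alpha\xrightarrow{o_1}p$. If for every $\alpha\in A$ one has $x_\alpha\le y_\alpha\le z_\alpha$, then $y_\alpha\xrightarrow{o_1}p$. (ii) Let $(x_\alpha)_{\alpha\in A}$, $(y_\alpha)_{\alpha\in A}$ and $(z_\alpha)_{\alpha\in A}$ be nets in $P$ such that $x_\alpha\xrightarrow{o_2}p\in P$ and $z_\alpha\xrightarrow{o_2}p$. If there is $\alpha_0\in A$ such that for each $\alpha\in A_{\ge\alpha_0}$ we have $x_\alpha\le y_\alpha\le z_\alpha$, then $y_\alpha\xrightarrow{o_2}p$. (iii) Let $(x_\alpha)_{\alpha\in A}$, $(y_\beta)_{\beta\in B}$ and $(z_\gamma)_{\gamma\in C}$ be nets in $P$ such that $x_\alpha\xrightarrow{o_3}p\in P$ and $z_\gamma\xrightarrow{o_3}p$. If for every $(\alpha_0,\gamma_0)\in A\times C$ there is $\beta_0\in B$ such that for all $\beta\in B_{\ge\beta_0}$ there is $(\alpha,\gamma)\in A_{\ge\alpha_0}\times C_{\ge\gamma_0}$ with $x_\alpha\le y_\beta\le z_\gamma$, then $y_\beta\xrightarrow{o_3}p$.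
   Context: Nets are indexed by non-empty upward directed partially ordered sets. For a net in a partially ordered set $P$, $x_\alpha\downarrow x$ means that $x_\alpha\le x_\beta$ whenever $\alpha\ge\beta$ and $\inf_\alpha x_\alpha=x$; $x_\alpha\uparrow x$ is defined dually. $A_{\ge\alpha_0}:=\{\alpha\in A;\ \alpha\ge\alpha_0\}$. Order convergence in $P$, for a net $(x_\alpha)_{\alpha\in A}$ in $P$ and $x\in P$: - $x_\alpha\xrightarrow{o_1}x$ if there are nets $(\hat x_\alpha)_{\alpha\in A}$, $(\check x_\alpha)_{\alpha\in A}$ in $P$ with $\hat x_\alpha\uparrow x$, $\check x_\alpha\downarrow x$ and $\hat x_\alpha\le x_\alpha\le\check x_\alpha$ for all $\alpha\in A$. - $x_\alpha\xrightarrow{o_2}x$ if there are such nets $(\hat x_\alpha)_{\alpha\in A}$, $(\check x_\alpha)_{\alpha\in A}$ with $\hat x_\alpha\uparrow x$, $\check x_\alpha\downarrow x$, and $\alpha_0\in A$ with $\hat x_\alpha\le x_\alpha\le\check x_\alpha$ for all $\alpha\in A_{\ge\alpha_0}$. - $x_\alpha\xrightarrow{o_3}x$ if there are nets $(\hat x_\beta)_{\beta\in B}$, $(\check x_\gamma)_{\gamma\in C}$ in $P$ and a map $\eta\colon B\times C\to A$ with $\hat x_\beta\uparrow x$, $\check x_\gamma\downarrow x$ and $\hat x_\beta\le x_\alpha\le\check x_\gamma$ for all $\beta\in B$, $\gamma\in C$, $\alpha\in A_{\ge\eta(\beta,\gamma)}$. *)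

theory Defs
  imports Main "HOL-Library.FuncSet" "HOL-Library.Lub_Glb"
begin

text \<open>
  The poset $P$ is a type of class \<^class>\<open>order\<close>. Index sets are explicit: a carrier \<open>A\<close> with a
  relation \<open>r\<close>, where \<open>(a, b) \<in> r\<close> means $a \le b$. A net indexed by \<open>A\<close> is a function on the
  ambient type of which only the values on \<open>A\<close> matter.
\<close>

definition directed_poset :: "'a set \<Rightarrow> 'a rel \<Rightarrow> bool" where
  "directed_poset A r \<longleftrightarrow>
     A \<noteq> {} \<and> partial_order_on A r \<and> (\<forall>a\<in>A. \<forall>b\<in>A. \<exists>c\<in>A. (a, c) \<in> r \<and> (b, c) \<in> r)"

definition tail :: "'a set \<Rightarrow> 'a rel \<Rightarrow> 'a \<Rightarrow> 'a set" where
  "tail A r a0 = {a \<in> A. (a0, a) \<in> r}"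

definition net_up :: "'a set \<Rightarrow> 'a rel \<Rightarrow> ('a \<Rightarrow> 'p::order) \<Rightarrow> 'p \<Rightarrow> bool" where
  "net_up A r x p \<longleftrightarrow> (\<forall>a\<in>A. \<forall>b\<in>A. (b, a) \<in> r \<longrightarrow> x b \<le> x a) \<and> isLub UNIV (x ` A) p"

definition net_down :: "'a set \<Rightarrow> 'a rel \<Rightarrow> ('a \<Rightarrow> 'p::order) \<Rightarrow> 'p \<Rightarrow> bool" where
  "net_down A r x p \<longleftrightarrow> (\<forall>a\<in>A. \<forall>b\<in>A. (b, a) \<in> r \<longrightarrow> x a \<le> x b) \<and> isGlb UNIV (x ` A) p"

definition o1_conv :: "'a set \<Rightarrow> 'a rel \<Rightarrow> ('a \<Rightarrow> 'p::order) \<Rightarrow> 'p \<Rightarrow> bool" where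
  "o1_conv A r x p \<longleftrightarrow>
     (\<exists>xl xu. net_up A r xl p \<and> net_down A r xu p \<and> (\<forall>a\<in>A. xl a \<le> x a \<and> x a \<le> xu a))"

definition o2_conv :: "'a set \<Rightarrow> 'a rel \<Rightarrow> ('a \<Rightarrow> 'p::order) \<Rightarrow> 'p \<Rightarrow> bool" where
  "o2_conv A r x p \<longleftrightarrow>
     (\<exists>xl xu. net_up A r xl p \<and> net_down A r xu p \<and>
        (\<exists>a0\<in>A. \<forall>a\<in>tail A r a0. xl a \<le> x a \<and> x a \<le> xu a))"

definition o3_witness ::
  "'b set \<Rightarrow> 'b rel \<Rightarrow> 'c set \<Rightarrow> 'c rel \<Rightarrow> 'a set \<Rightarrow> 'a rel \<Rightarrow> ('a \<Rightarrow> 'p::order) \<Rightarrow> 'p \<Rightarrow> bool" where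
  "o3_witness B s C t A r x p \<longleftrightarrow>
     directed_poset B s \<and> directed_poset C t \<and>
     (\<exists>xl xu \<eta>. net_up B s xl p \<and> net_down C t xu p \<and> \<eta> \<in> B \<times> C \<rightarrow> A \<and>
        (\<forall>b\<in>B. \<forall>c\<in>C. \<forall>a\<in>tail A r (\<eta> (b, c)). xl b \<le> x a \<and> x a \<le> xu c))"

text \<open>
  HOL cannot quantify existentially over the types of the index sets \<open>B\<close> and \<open>C\<close>, so they are taken
  in the type \<open>'p\<close> of $P$ itself, with arbitrary directed orders. This is no restriction:
  by \<open>o3_conv_if_witness\<close> below, witnesses over index sets of any types yield such witnesses.
\<close>

definition o3_conv :: "'a set \<Rightarrow> 'a rel \<Rightarrow> ('a \<Rightarrow> 'p::order) \<Rightarrow> 'p \<Rightarrow> bool" where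
  "o3_conv A r x p \<longleftrightarrow>
     (\<exists>(B :: 'p set) s (C :: 'p set) t. o3_witness B s C t A r x p)"

lemma o3_conv_if_witness:
  fixes B :: "'b set" and C :: "'c set" and x :: "'a \<Rightarrow> 'p::order"
  assumes "o3_witness B s C t A r x p"
  shows "o3_conv A r x p"
proof -
  from assms obtain xl xu \<eta> where B: "directed_poset B s" and C: "directed_poset C t"
    and up: "net_up B s xl p" and down: "net_down C t xu p" and eta: "\<eta> \<in> B \<times> C \<rightarrow> A"
    and bnd: "\<And>b c a. b \<in> B \<Longrightarrow> c \<in> C \<Longrightarrow> a \<in> tail A r (\<eta> (b, c)) \<Longrightarrow> xl b \<le> x a \<and> x a \<le> xu c"
    unfolding o3_witness_def by blast
  let ?B = "xl ` B" and ?C = "xu ` C"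
  let ?s = "{(u, v). u \<in> ?B \<and> v \<in> ?B \<and> u \<le> v}"
  let ?t = "{(u, v). u \<in> ?C \<and> v \<in> ?C \<and> v \<le> u}"
  let ?\<eta> = "\<lambda>(u, v). \<eta> (inv_into B xl u, inv_into C xu v)"
  have "directed_poset ?B ?s"
    unfolding directed_poset_def
  proof (intro conjI ballI)
    show "?B \<noteq> {}" using B by (simp add: directed_poset_def)
    show "partial_order_on ?B ?s"
      by (auto simp: partial_order_on_def preorder_on_def refl_on_def trans_def antisym_def)
    fix u v assume "u \<in> ?B" "v \<in> ?B"
    then obtain a b where "a \<in> B" "b \<in> B" and uv: "u = xl a" "v = xl b" by blast
    moreover from this B obtain c where "c \<in> B" "(a, c) \<in> s" "(b, c) \<in> s"
      unfolding directed_poset_def by blast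
    ultimately show "\<exists>w\<in>?B. (u, w) \<in> ?s \<and> (v, w) \<in> ?s"
      using up unfolding net_up_def by blast
  qed
  moreover have "directed_poset ?C ?t"
    unfolding directed_poset_def
  proof (intro conjI ballI)
    show "?C \<noteq> {}" using C by (simp add: directed_poset_def)
    show "partial_order_on ?C ?t"
      by (auto simp: partial_order_on_def preorder_on_def refl_on_def trans_def antisym_def)
    fix u v assume "u \<in> ?C" "v \<in> ?C"
    then obtain a b where "a \<in> C" "b \<in> C" and uv: "u = xu a" "v = xu b" by blast
    moreover from this C obtain c where "c \<in> C" "(a, c) \<in> t" "(b, c) \<in> t"
      unfolding directed_poset_def by blast
    ultimately show "\<exists>w\<in>?C. (u, w) \<in> ?t \<and> (v, w) \<in> ?t"
      using down unfolding net_down_def by blast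
  qed
  moreover have "net_up ?B ?s id p" "net_down ?C ?t id p"
    using up down by (auto simp: net_up_def net_down_def)
  moreover have "?\<eta> \<in> ?B \<times> ?C \<rightarrow> A"
    using eta by (auto intro!: funcset_mem[OF eta] inv_into_into)
  moreover have "\<forall>u\<in>?B. \<forall>v\<in>?C. \<forall>a\<in>tail A r (?\<eta> (u, v)). id u \<le> x a \<and> x a \<le> id v"
  proof (intro ballI)
    fix u v a assume "u \<in> ?B" "v \<in> ?C" "a \<in> tail A r (?\<eta> (u, v))"
    then show "id u \<le> x a \<and> x a \<le> id v"
      using bnd[of "inv_into B xl u" "inv_into C xu v" a]
      by (simp add: inv_into_into f_inv_into_f)
  qed
  ultimately have "o3_witness ?B ?s ?C ?t A r x p"
    unfolding o3_witness_def by blast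
  then show ?thesis unfolding o3_conv_def by blast
qed

end

theory Submission
  imports Defs
begin

text \<open>In each of the three modes, convergence to \<open>p\<close> means being trapped between
  a net increasing to \<open>p\<close> and a net decreasing to \<open>p\<close>, and the conditions
  on these two nets are independent of each other. So the lower net of \<open>x\<close> and the
  upper net of \<open>z\<close> can be combined and squeeze \<open>y\<close>. What remains is to
  find where the combined bounds hold: everywhere for \<open>o1_conv_squeeze\<close>, on a common
  tail for \<open>o2_conv_squeeze\<close>, and beyond an index chosen for each pair of bounds for
  \<open>o3_conv_squeeze\<close>.\<close>

lemma tail_antimono:
  assumes "directed_poset A r" and "(a, b) \<in> r"
  shows "tail A r b \<subseteq> tail A r a"
  using assms unfolding directed_poset_def partial_order_on_def preorder_on_def tail_def
  by (blast dest: transD)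

lemma directed_posetE:
  assumes "directed_poset A r" and "a \<in> A" and "b \<in> A"
  obtains c where "c \<in> A" "(a, c) \<in> r" "(b, c) \<in> r"
  using assms unfolding directed_poset_def by blast

lemma o1_conv_squeeze:
  assumes "o1_conv A r x p" and "o1_conv A r z p"
    and "\<And>a. a \<in> A \<Longrightarrow> x a \<le> y a \<and> y a \<le> z a"
  shows "o1_conv A r y p"
  using assms unfolding o1_conv_def by (meson order_trans)

text \<open>Three inequalities each hold eventually; directedness, used twice, gives one index
  beyond which all three hold.\<close>

lemma o2_conv_squeeze:
  assumes A: "directed_poset A r" and "o2_conv A r x p" and "o2_conv A r z p"
    and a0: "a0 \<in> A" and le: "\<And>a. a \<in> tail A r a0 \<Longrightarrow> x a \<le> y a \<and> y a \<le> z a"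
  shows "o2_conv A r y p"
proof -
  from assms(2) obtain xl a1 where xl: "net_up A r xl p" and a1: "a1 \<in> A"
    and lex: "\<And>a. a \<in> tail A r a1 \<Longrightarrow> xl a \<le> x a"
    unfolding o2_conv_def by blast
  from assms(3) obtain zu a2 where zu: "net_down A r zu p" and a2: "a2 \<in> A"
    and zle: "\<And>a. a \<in> tail A r a2 \<Longrightarrow> z a \<le> zu a"
    unfolding o2_conv_def by blast
  obtain b where b: "b \<in> A" "(a1, b) \<in> r" "(a2, b) \<in> r"
    using directed_posetE[OF A a1 a2] .
  obtain c where c: "c \<in> A" "(a0, c) \<in> r" "(b, c) \<in> r"
    using directed_posetE[OF A a0 b(1)] .
  have "xl a \<le> y a \<and> y a \<le> zu a" if "a \<in> tail A r c" for a
  proof -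
    have "a \<in> tail A r a0" "a \<in> tail A r a1" "a \<in> tail A r a2"
      using that b c tail_antimono[OF A] by blast+
    then show ?thesis using le lex zle by (meson order_trans)
  qed
  with xl zu c(1) show ?thesis unfolding o2_conv_def by blast
qed

text \<open>The lower and upper nets of an o3 witness may have unrelated index sets, so those taken
  from \<open>x\<close> and from \<open>z\<close> need not be reindexed. Only a new index map into
  \<open>B\<close> has to be built.\<close>

lemma o3_conv_squeeze:
  fixes p :: "'p::order"
  assumes "o3_conv A r x p" and "o3_conv C t z p"
    and sq: "\<And>a0 c0. a0 \<in> A \<Longrightarrow> c0 \<in> C \<Longrightarrow> \<exists>b0\<in>B. \<forall>b\<in>tail B s b0.
           \<exists>a\<in>tail A r a0. \<exists>c\<in>tail C t c0. x a \<le> y b \<and> y b \<le> z c"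
  shows "o3_conv B s y p"
proof -
  from assms(1) obtain D E :: "'p set" and d e xl xu \<eta>
    where D: "directed_poset D d" and E: "directed_poset E e"
      and xl: "net_up D d xl p" and eta: "\<eta> \<in> D \<times> E \<rightarrow> A"
      and lex: "\<And>i j a. i \<in> D \<Longrightarrow> j \<in> E \<Longrightarrow> a \<in> tail A r (\<eta> (i, j)) \<Longrightarrow> xl i \<le> x a \<and> x a \<le> xu j"
    unfolding o3_conv_def o3_witness_def by blast
  from assms(2) obtain F G :: "'p set" and f g zl zu \<theta>
    where F: "directed_poset F f" and G: "directed_poset G g"
      and zu: "net_down G g zu p" and theta: "\<theta> \<in> F \<times> G \<rightarrow> C"
      and zle: "\<And>i j c. i \<in> F \<Longrightarrow> j \<in> G \<Longrightarrow> c \<in> tail C t (\<theta> (i, j)) \<Longrightarrow> zl i \<le> z c \<and> z c \<le> zu j"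
    unfolding o3_conv_def o3_witness_def by blast
  \<comment> \<open>The maps \<open>\<eta>\<close> and \<open>\<theta>\<close> take pairs, but only
    the lower bound of \<open>x\<close> and the upper bound of \<open>z\<close> matter. The
    discarded coordinates are therefore frozen at arbitrary \<open>j0\<close> and
    \<open>i0\<close>.\<close>
  obtain j0 where j0: "j0 \<in> E" using E unfolding directed_poset_def by blast
  obtain i0 where i0: "i0 \<in> F" using F unfolding directed_poset_def by blast
  have "\<exists>b0\<in>B. \<forall>b\<in>tail B s b0. xl i \<le> y b \<and> y b \<le> zu j" if i: "i \<in> D" and j: "j \<in> G" for i j
  proof -
    \<comment> \<open>With these thresholds in \<open>sq\<close>, each late \<open>y b\<close> lies
      between some \<open>x a\<close> with \<open>xl i \<le> x a\<close> and some \<open>z c\<close>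
      with \<open>z c \<le> zu j\<close>. The indices \<open>a\<close> and \<open>c\<close> may vary
      with \<open>b\<close>, but the outer bounds do not.\<close>
    have "\<eta> (i, j0) \<in> A" "\<theta> (i0, j) \<in> C" using eta theta i j i0 j0 by auto
    from sq[OF this] show ?thesis using lex[OF i j0] zle[OF i0 j] by (meson order_trans)
  qed
  \<comment> \<open>Choosing a threshold for each pair \<open>(i, j)\<close> yields the index map of
    the new witness.\<close>
  then obtain \<zeta> where zeta: "\<And>i j. i \<in> D \<Longrightarrow> j \<in> G \<Longrightarrow>
      \<zeta> i j \<in> B \<and> (\<forall>b\<in>tail B s (\<zeta> i j). xl i \<le> y b \<and> y b \<le> zu j)"
    by metis
  have "o3_witness D d G g B s y p"
    unfolding o3_witness_def
  proof (intro conjI exI D G)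
    show "net_up D d xl p" by (fact xl)
    show "net_down G g zu p" by (fact zu)
    show "case_prod \<zeta> \<in> D \<times> G \<rightarrow> B" using zeta by auto
    show "\<forall>i\<in>D. \<forall>j\<in>G. \<forall>b\<in>tail B s (case_prod \<zeta> (i, j)). xl i \<le> y b \<and> y b \<le> zu j"
      using zeta by simp
  qed
  then show ?thesis by (rule o3_conv_if_witness)
qed

theorem proposition3p20:
  shows
    "(\<forall>(A :: 'a set) r (x :: 'a \<Rightarrow> 'p::order) y z p.
        directed_poset A r \<longrightarrow> o1_conv A r x p \<longrightarrow> o1_conv A r z p \<longrightarrow>
        (\<forall>a\<in>A. x a \<le> y a \<and> y a \<le> z a) \<longrightarrow>
        o1_conv A r y p) \<and>
     (\<forall>(A :: 'a set) r (x :: 'a \<Rightarrow> 'p) y z p.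
        directed_poset A r \<longrightarrow> o2_conv A r x p \<longrightarrow> o2_conv A r z p \<longrightarrow>
        (\<exists>a0\<in>A. \<forall>a\<in>tail A r a0. x a \<le> y a \<and> y a \<le> z a) \<longrightarrow>
        o2_conv A r y p) \<and>
     (\<forall>(A :: 'a set) r (B :: 'b set) s (C :: 'c set) t
        (x :: 'a \<Rightarrow> 'p) (y :: 'b \<Rightarrow> 'p) (z :: 'c \<Rightarrow> 'p) p.
        directed_poset A r \<longrightarrow> directed_poset B s \<longrightarrow> directed_poset C t \<longrightarrow>
        o3_conv A r x p \<longrightarrow> o3_conv C t z p \<longrightarrow>
        (\<forall>a0\<in>A. \<forall>c0\<in>C. \<exists>b0\<in>B. \<forall>b\<in>tail B s b0.
           \<exists>a\<in>tail A r a0. \<exists>c\<in>tail C t c0. x a \<le> y b \<and> y b \<le> z c) \<longrightarrow>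
        o3_conv B s y p)"
  apply (intro conjI allI impI)
  subgoal by (erule (1) o1_conv_squeeze) blast
  subgoal by (elim bexE, erule (3) o2_conv_squeeze) blast
  subgoal by (erule (1) o3_conv_squeeze) blast
  done

end
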